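(* Let $f:\mathbb{R}^n\to(-\infty,+\infty]$ and $g:\mathbb{R}^m\to(-\infty,+\infty]$ be proper, closed and convex, with $f$ $\sigma$-strongly convex for some $\sigma>0$, and let $\mathbf{A}$ be a real $m\times n$ matrix. Let $\mathbf{y}_*$ be a maximizer of the dual function $q$. Let $\{\mathbf{y}_k,\mathbf{w}_k\}$ be the sequence generated by the GFDPG method (defined in the context) with $t_k=\frac{k+a}{a}$ for any $a>2$. Then, for $k\ge1$, the corresponding primal sequence satisfies $$\min\Big\{\{\tilde H(\mathbf{x}(\mathbf{y}_i),\mathbf{z}(\mathbf{y}_i))-q(\mathbf{y}_i)\}_{i=1}^k,\ \tilde H\big(\mathbf{x}(p_{L_k'}(\mathbf{y}_k)),\mathbf{z}(p_{L_k'}(\mathbf{y}_k))\big)-q(p_{L_k'}(\mathbf{y}_k))\Big\}\le\frac{a\sqrt6}{\sqrt{a-2}}(L_k'+L_F)\big(\|\mathbf{y}_0-\mathbf{y}_*\|+\|\mathbf{y}_*\|\big)\frac{\|\mathbf{y}_0-\mathbf{y}_*\|}{k^{1.5}},$$ and, if moreover $g$ is subdifferentiable at every $\mathbf{z}\in\mathbb{R}^m$ with $\gamma_g:=\max_{\mathbf{z}\in\mathbb{R}^m}\max_{\mathbf{d}\in\partial g(\mathbf{z})}\|\mathbf{d}\|<\infty$, the sequence satisfies $$\min\Big\{\{H(\mathbf{x}(\mathbf{y}_i))-q(\mathbf{y}_i)\}_{i=1}^k,\ H\big(\mathbf{x}(p_{L_k'}(\mathbf{y}_k))\big)-q(p_{L_k'}(\mathbf{y}_k))\Big\}\le\frac{a\sqrt6}{\sqrt{a-2}}(L_k'+L_F)\big(\|\mathbf{y}_0-\mathbf{y}_*\|+\|\mathbf{y}_*\|+\gamma_g\big)\frac{\|\mathbf{y}_0-\mathbf{y}_*\|}{k^{1.5}},$$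 for any $L_k'$ that satisfies $\tilde q(p_{L_k'}(\mathbf{y}_k))\le Q_{L_k'}(p_{L_k'}(\mathbf{y}_k),\mathbf{y}_k)$.
   Context: $H(\mathbf{x}):=f(\mathbf{x})+g(\mathbf{A}\mathbf{x})$ and $\tilde H(\mathbf{x},\mathbf{z}):=f(\mathbf{x})+g(\mathbf{z})$. Convex conjugates: $f^*(\mathbf{u})=\max_{\mathbf{x}}\{\langle\mathbf{u},\mathbf{x}\rangle-f(\mathbf{x})\}$, $g^*(\mathbf{y})=\max_{\mathbf{z}}\{\langle\mathbf{y},\mathbf{z}\rangle-g(\mathbf{z})\}$. Put $F(\mathbf{y}):=f^*(\mathbf{A}^\top\mathbf{y})$ (differentiable, with gradient Lipschitz with constant $L_F:=\|\mathbf{A}\|^2/\sigma$) and $G(\mathbf{y}):=g^*(-\mathbf{y})$. The dual function is $q(\mathbf{y}):=\min_{\mathbf{x},\mathbf{z}}\{\tilde H(\mathbf{x},\mathbf{z})-\langle\mathbf{y},\mathbf{A}\mathbf{x}-\mathbf{z}\rangle\}=-F(\mathbf{y})-G(\mathbf{y})$, and $\tilde q:=-q=F+G$; $\mathbf{y}_*$ is equivalently a minimizer of $\tilde q$. For $L>0$ and $\mathbf{y},\mathbf{w}\in\mathbb{R}^m$, $$Q_L(\mathbf{y},\mathbf{w}):=F(\mathbf{w})+\langle\mathbf{y}-\mathbf{w},\nabla F(\mathbf{w})\rangle+\tfrac{L}{2}\|\mathbf{y}-\mathbf{w}\|^2+G(\mathbf{y}),\qquad p_L(\mathbf{w}):=\operatorname{argmin}_{\mathbf{y}}Q_L(\mathbf{y},\mathbf{w}).$$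 The primal vectors associated with a dual vector $\mathbf{y}\in\mathbb{R}^m$ are defined by $\mathbf{x}(\mathbf{y}):=\operatorname{argmax}_{\mathbf{x}}\{\langle\mathbf{A}^\top\mathbf{y},\mathbf{x}\rangle-f(\mathbf{x})\}$ and $\mathbf{z}(\mathbf{y})\in\operatorname{argmin}_{\mathbf{z}}\{\langle\mathbf{y},\mathbf{z}\rangle+g(\mathbf{z})\}$. $\|\cdot\|$ is the Euclidean norm on vectors and $\|\mathbf{A}\|$ the operator norm. GFDPG method (with backtracking): given $L_0>0$, $\mathbf{y}_0=\mathbf{w}_0\in\mathbb{R}^m$, $t_0=T_0\in(0,1]$, for $k\ge1$: choose $L_k$ such that $L_{k-1}\le L_k$ and $\tilde q(p_{L_k}(\mathbf{w}_{k-1}))\le Q_{L_k}(p_{L_k}(\mathbf{w}_{k-1}),\mathbf{w}_{k-1})$; set $\mathbf{y}_k=p_{L_k}(\mathbf{w}_{k-1})$; choose $t_k$ such that $t_k>0$ and $t_k^2\le T_k:=\sum_{i=0}^kt_i$; set $$\mathbf{w}_k=\mathbf{y}_k+\frac{(T_{k-1}-t_{k-1})t_k}{t_{k-1}T_k}(\mathbf{y}_k-\mathbf{y}_{k-1})+\frac{(t_{k-1}^2-T_{k-1})t_k}{t_{k-1}T_k}(\mathbf{y}_k-\mathbf{w}_{k-1}).$$ Here $t_k=\frac{k+a}{a}$ for all $k\ge0$ (so $t_0=1$).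
   Formalization: The bound is proved for L_k' ≥ L_k (it can fail for smaller L_k'), and the first inequality for a suitable choice of z(y) in the argmin, fixed in advance from f, g, A (it can fail for an arbitrary choice when the argmin is not unique). *)

theory Defs
  imports "HOL-Analysis.Analysis"
begin

section \<open>Extended-real-valued convex functions\<close>

definition proper_fun :: "('a \<Rightarrow> ereal) \<Rightarrow> bool" where
  "proper_fun h \<longleftrightarrow> (\<forall>x. h x \<noteq> -\<infinity>) \<and> (\<exists>x. h x \<noteq> \<infinity>)"

definition epi :: "('a \<Rightarrow> ereal) \<Rightarrow> ('a \<times> real) set" where
  "epi h = {(x, r). h x \<le> ereal r}"

definition closed_fun :: "('a::euclidean_space \<Rightarrow> ereal) \<Rightarrow> bool" where
  "closed_fun h \<longleftrightarrow> closed (epi h)"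

definition convex_fun :: "('a::euclidean_space \<Rightarrow> ereal) \<Rightarrow> bool" where
  "convex_fun h \<longleftrightarrow> convex (epi h)"

(* The weights range over the open interval, so that no product of 0 and infinity occurs. *)
definition strongly_convex_fun :: "real \<Rightarrow> ('a::euclidean_space \<Rightarrow> ereal) \<Rightarrow> bool" where
  "strongly_convex_fun \<sigma> h \<longleftrightarrow>
     (\<forall>x y. \<forall>c\<in>{0<..<1}.
        h (c *\<^sub>R x + (1 - c) *\<^sub>R y)
          \<le> ereal c * h x + ereal (1 - c) * h y - ereal (\<sigma> / 2 * c * (1 - c) * (norm (x - y))\<^sup>2))"

definition conj_fun :: "('a::euclidean_space \<Rightarrow> ereal) \<Rightarrow> 'a \<Rightarrow> ereal" where
  "conj_fun h u = (SUP x. ereal (u \<bullet> x) - h x)"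

definition subdiff :: "('a::euclidean_space \<Rightarrow> ereal) \<Rightarrow> 'a \<Rightarrow> 'a set" where
  "subdiff h x = {d. \<forall>v. h x + ereal (d \<bullet> (v - x)) \<le> h v}"

definition grad :: "('a::euclidean_space \<Rightarrow> real) \<Rightarrow> 'a \<Rightarrow> 'a" where
  "grad h x = (THE d. GDERIV h x :> d)"


section \<open>The primal and dual problems\<close>

definition primal_H :: "(real^'n \<Rightarrow> ereal) \<Rightarrow> (real^'m \<Rightarrow> ereal) \<Rightarrow> real^'n^'m \<Rightarrow> real^'n \<Rightarrow> ereal" where
  "primal_H f g A x = f x + g (A *v x)"

definition primal_Ht :: "(real^'n \<Rightarrow> ereal) \<Rightarrow> (real^'m \<Rightarrow> ereal) \<Rightarrow> real^'n \<Rightarrow> real^'m \<Rightarrow> ereal" where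
  "primal_Ht f g x z = f x + g z"

definition dual_F :: "(real^'n \<Rightarrow> ereal) \<Rightarrow> real^'n^'m \<Rightarrow> real^'m \<Rightarrow> ereal" where
  "dual_F f A y = conj_fun f (transpose A *v y)"

definition dual_G :: "(real^'m \<Rightarrow> ereal) \<Rightarrow> real^'m \<Rightarrow> ereal" where
  "dual_G g y = conj_fun g (- y)"

definition dual_q :: "(real^'n \<Rightarrow> ereal) \<Rightarrow> (real^'m \<Rightarrow> ereal) \<Rightarrow> real^'n^'m \<Rightarrow> real^'m \<Rightarrow> ereal" where
  "dual_q f g A y = (INF (x, z)\<in>UNIV. primal_Ht f g x z - ereal (y \<bullet> (A *v x - z)))"

definition dual_qt :: "(real^'n \<Rightarrow> ereal) \<Rightarrow> (real^'m \<Rightarrow> ereal) \<Rightarrow> real^'n^'m \<Rightarrow> real^'m \<Rightarrow> ereal" where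
  "dual_qt f g A y = - dual_q f g A y"

definition lip_F :: "real \<Rightarrow> real^'n^'m \<Rightarrow> real" where
  "lip_F \<sigma> A = (onorm ((*v) A))\<^sup>2 / \<sigma>"

(* dual_F f A is finite everywhere when f is proper, closed and strongly convex, so passing to
   real values in order to differentiate it loses nothing. *)
definition dual_Q ::
  "(real^'n \<Rightarrow> ereal) \<Rightarrow> (real^'m \<Rightarrow> ereal) \<Rightarrow> real^'n^'m \<Rightarrow> real \<Rightarrow> real^'m \<Rightarrow> real^'m \<Rightarrow> ereal" where
  "dual_Q f g A L y w =
     dual_F f A w
     + ereal ((y - w) \<bullet> grad (\<lambda>v. real_of_ereal (dual_F f A v)) w + L / 2 * (norm (y - w))\<^sup>2)
     + dual_G g y"

definition prox_step ::
  "(real^'n \<Rightarrow> ereal) \<Rightarrow> (real^'m \<Rightarrow> ereal) \<Rightarrow> real^'n^'m \<Rightarrow> real \<Rightarrow> real^'m \<Rightarrow> real^'m" where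
  "prox_step f g A L w = arg_min (\<lambda>y. dual_Q f g A L y w) (\<lambda>_. True)"

definition descent_cond ::
  "(real^'n \<Rightarrow> ereal) \<Rightarrow> (real^'m \<Rightarrow> ereal) \<Rightarrow> real^'n^'m \<Rightarrow> real \<Rightarrow> real^'m \<Rightarrow> bool" where
  "descent_cond f g A L w \<longleftrightarrow>
     dual_qt f g A (prox_step f g A L w) \<le> dual_Q f g A L (prox_step f g A L w) w"

definition primal_x :: "(real^'n \<Rightarrow> ereal) \<Rightarrow> real^'n^'m \<Rightarrow> real^'m \<Rightarrow> real^'n" where
  "primal_x f A y = arg_max (\<lambda>x. ereal ((transpose A *v y) \<bullet> x) - f x) (\<lambda>_. True)"

definition primal_z_set :: "(real^'m \<Rightarrow> ereal) \<Rightarrow> real^'m \<Rightarrow> (real^'m) set" where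
  "primal_z_set g y = {z. is_arg_min (\<lambda>z. ereal (y \<bullet> z) + g z) (\<lambda>_. True) z}"

(* A choice z(y) of a minimizer. For a general y the set of minimizers may be empty; at the
   points p_L(w), which are the only ones that matter, it never is, and the second
   conjunct asserts that z is a genuine minimizer there. *)
definition primal_z_selection ::
  "(real^'n \<Rightarrow> ereal) \<Rightarrow> (real^'m \<Rightarrow> ereal) \<Rightarrow> real^'n^'m \<Rightarrow> (real^'m \<Rightarrow> real^'m) \<Rightarrow> bool" where
  "primal_z_selection f g A z \<longleftrightarrow>
     (\<forall>y. primal_z_set g y \<noteq> {} \<longrightarrow> z y \<in> primal_z_set g y) \<and>
     (\<forall>L>0. \<forall>w. z (prox_step f g A L w) \<in> primal_z_set g (prox_step f g A L w))"

definition all_subgradients :: "('a::euclidean_space \<Rightarrow> ereal) \<Rightarrow> 'a set" where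
  "all_subgradients h = (\<Union>x. subdiff h x)"

(* Meaningful when the norms of the subgradients are bounded. *)
definition max_subgradient_norm :: "('a::euclidean_space \<Rightarrow> ereal) \<Rightarrow> real" where
  "max_subgradient_norm h = (SUP d\<in>all_subgradients h. norm d)"


section \<open>The generalized fast dual proximal gradient method\<close>

definition gfdpg ::
  "(real^'n \<Rightarrow> ereal) \<Rightarrow> (real^'m \<Rightarrow> ereal) \<Rightarrow> real^'n^'m \<Rightarrow>
   (nat \<Rightarrow> real) \<Rightarrow> (nat \<Rightarrow> real) \<Rightarrow> (nat \<Rightarrow> real^'m) \<Rightarrow> (nat \<Rightarrow> real^'m) \<Rightarrow> bool" where
  "gfdpg f g A L t y w \<longleftrightarrow>
     (let T = (\<lambda>k. \<Sum>i\<le>k. t i) in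
      0 < L 0 \<and> w 0 = y 0 \<and> 0 < t 0 \<and> t 0 \<le> 1 \<and>
      (\<forall>k\<ge>1.
         L (k - 1) \<le> L k \<and>
         descent_cond f g A (L k) (w (k - 1)) \<and>
         y k = prox_step f g A (L k) (w (k - 1)) \<and>
         0 < t k \<and> (t k)\<^sup>2 \<le> T k \<and>
         w k = y k
           + ((T (k - 1) - t (k - 1)) * t k / (t (k - 1) * T k)) *\<^sub>R (y k - y (k - 1))
           + (((t (k - 1))\<^sup>2 - T (k - 1)) * t k / (t (k - 1) * T k)) *\<^sub>R (y k - w (k - 1))))"

end

theory Submission
  imports Defs
begin

text \<open>Write R for the distance from the first iterate to the maximizer y* and T for the partial sums of
  t. With s = (T w - (T - t) y) / t, the quantity 2 (T - t) / L * (q(y*) - q(y)) + |s - y*|^2 drops in each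
  step by at least (T - t^2) |y' - w|^2, where y' is the next iterate. For t = (k + a) / a the
  weights T - t^2 grow quadratically, so a residual of size O(R / k^1.5) must occur among the
  iterates or in the final proximal step. At a proximal point p of w, strong convexity of f makes
  A x(p) and z(p) differ by at most (L + L_F) |p - w|, and the primal-dual gap is the inner product of p
  with that difference; since all the iterates stay within R of y*, this bounds the gap.\<close>

section \<open>Strongly convex functions\<close>

text \<open>For t = (k + a) / a the weight T - t^2 has leading term (a - 2) k^2 / (2 a^2), so k
  weights sum to about (a - 2) k^3 / (6 a^2). The square root of the reciprocal is the constant a
  sqrt 6 / sqrt (a - 2) together with the power 1.5; a > 2 makes the cubic term positive. The extra
  candidate, a proximal step from the last iterate, serves to use the value term left over at the
  end: such a step raises q by at least L'/2 times its squared residual, so the remaining dual gap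
  becomes one more residual, with weight T. After one iteration this is the only contribution,
  because T - t^2 vanishes at index 0. One obstacle is z(y): the minimizers need not be unique and
  the gap depends on which one is taken. A single selection has to be fixed before the run is known,
  whereas the minimizer that a proximal step supplies depends on L and w.\<close>

lemma closed_fun_level:
  assumes "closed_fun h" shows "closed {x. h x \<le> ereal r}"
proof -
  have "closed ((\<lambda>x. (x, r)) -` epi h)"
    using assms by (intro closed_vimage) (auto simp: closed_fun_def intro!: continuous_intros)
  then show ?thesis by (simp add: epi_def vimage_def)
qed

text \<open>Compactness is applied to the closed sublevel sets with levels above the infimum
  \<open>m\<close>: finitely many are nested, so the lowest one decides whether they meet
  \<open>K\<close>. Infinite \<open>m\<close> is covered; for \<open>m\<close> = \<infinity> the
  family is empty.\<close>

lemma closed_fun_attains_min: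
  assumes "closed_fun h" "compact K" "K \<noteq> {}"
  shows "\<exists>x\<in>K. \<forall>y\<in>K. h x \<le> h y"
proof -
  define m where "m = (INF x\<in>K. h x)"
  define \<F> where "\<F> = (\<lambda>r. {x. h x \<le> ereal r}) ` {r. m < ereal r}"
  have "K \<inter> \<Inter>\<F> \<noteq> {}"
  proof (rule compact_imp_fip[OF assms(2)])
    show "closed T" if "T \<in> \<F>" for T
      using that closed_fun_level[OF assms(1)] by (auto simp: \<F>_def)
  next
    fix \<F>' assume fin: "finite \<F>'" and sub: "\<F>' \<subseteq> \<F>"
    then obtain R where R: "finite R" "R \<subseteq> {r. m < ereal r}" "\<F>' = (\<lambda>r. {x. h x \<le> ereal r}) ` R"
      unfolding \<F>_def by (meson finite_subset_image)
    show "K \<inter> \<Inter>\<F>' \<noteq> {}"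
    proof (cases "R = {}")
      case True then show ?thesis using R assms(3) by auto
    next
      case False
      then have "m < ereal (Min R)" using R Min_in by blast
      then obtain x where "x \<in> K" "h x < ereal (Min R)" unfolding m_def by (auto simp: INF_less_iff)
      moreover have "h x \<le> ereal r" if "r \<in> R" for r
      proof -
        have "ereal (Min R) \<le> ereal r" using R(1) that by simp
        with \<open>h x < ereal (Min R)\<close> show ?thesis by (meson less_imp_le order_trans)
      qed
      ultimately have "x \<in> K \<inter> \<Inter>\<F>'" using R(3) by auto
      then show ?thesis by blast
    qed
  qed
  then obtain x where x: "x \<in> K" "x \<in> \<Inter>\<F>" by blast
  have "h x \<le> m"
  proof (rule ccontr)
    assume "\<not> h x \<le> m"
    then have "m < h x" by simp
    from ereal_dense2[OF this] obtain r where "m < ereal r" "ereal r < h x" by blast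
    moreover from this(1) x(2) have "h x \<le> ereal r" unfolding \<F>_def by blast
    ultimately show False by simp
  qed
  then show ?thesis using x(1) unfolding m_def by (meson INF_lower order_trans)
qed

text \<open>Compare \<open>x\<close> with the point at fraction \<open>c\<close> towards
  \<open>v\<close>, divide the strong convexity inequality by \<open>c\<close>, and let
  \<open>c\<close> tend to 0 from the right.\<close>

lemma strongly_convex_fun_growth:
  assumes h: "strongly_convex_fun \<sigma> h" and fin: "h x = ereal m" and min: "\<And>v. h x \<le> h v"
  shows "ereal (m + \<sigma> / 2 * (norm (v - x))\<^sup>2) \<le> h v"
proof (cases "h v")
  case (real r)
  have "\<sigma> / 2 * (1 - c) * (norm (v - x))\<^sup>2 \<le> r - m" if c: "c \<in> {0<..<1}" for c
  proof -
    have "ereal m \<le> h (c *\<^sub>R v + (1 - c) *\<^sub>R x)" using min fin by metis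
    also have "\<dots> \<le> ereal c * h v + ereal (1 - c) * h x - ereal (\<sigma> / 2 * c * (1 - c) * (norm (v - x))\<^sup>2)"
      using h c by (auto simp: strongly_convex_fun_def)
    finally have "m \<le> c * r + (1 - c) * m - \<sigma> / 2 * c * (1 - c) * (norm (v - x))\<^sup>2"
      by (simp add: real fin)
    then have "c * (\<sigma> / 2 * (1 - c) * (norm (v - x))\<^sup>2) \<le> c * (r - m)" by (simp add: algebra_simps)
    then show ?thesis using c by simp
  qed
  then have *: "eventually (\<lambda>c. \<sigma> / 2 * (1 - c) * (norm (v - x))\<^sup>2 \<le> r - m) (at_right 0)"
    by (auto simp: eventually_at_right_field intro!: exI[of _ 1])
  have "((\<lambda>c. \<sigma> / 2 * (1 - c) * (norm (v - x))\<^sup>2) \<longlongrightarrow> \<sigma> / 2 * (1 - 0) * (norm (v - x))\<^sup>2) (at_right 0)"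
    by (intro tendsto_intros)
  from tendsto_upperbound[OF this *] show ?thesis by (simp add: real)
next
  case MInf then show ?thesis using min[of v] fin by simp
qed simp

text \<open>Strong convexity bounds the sublevel set of a finite point \<open>x0\<close>, so a
  minimizer over that compact set exists and is global. The minimum \<open>M\<close> over the unit
  ball serves as the lower bound needed for this.\<close>

lemma strongly_convex_fun_has_min:
  fixes h :: "'a::euclidean_space \<Rightarrow> ereal"
  assumes "proper_fun h" "closed_fun h" "0 < \<sigma>" and sc: "strongly_convex_fun \<sigma> h"
  shows "\<exists>x m. h x = ereal m \<and> (\<forall>v. h x \<le> h v)"
proof -
  obtain x0 m0 where x0: "h x0 = ereal m0"
    using assms(1) unfolding proper_fun_def by (metis ereal_cases)
  obtain b where b: "b \<in> cball x0 1" "\<And>v. v \<in> cball x0 1 \<Longrightarrow> h b \<le> h v"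
    using closed_fun_attains_min[OF assms(2), of "cball x0 1"] by auto
  have "h b \<le> h x0" using b(2)[of x0] by simp
  then obtain M where M: "h b = ereal M"
    using assms(1) x0 unfolding proper_fun_def by (cases "h b") auto
  define K where "K = {x. h x \<le> ereal m0}"
  have bd: "norm (v - x0) \<le> 1 + 2 * (m0 - M) / \<sigma>" if "v \<in> K" for v
  proof (cases "norm (v - x0) \<le> 1")
    case True
    then show ?thesis using \<open>h b \<le> h x0\<close> M x0 \<open>0 < \<sigma>\<close> by (simp add: add_increasing2)
  next
    case False
    define r where "r = norm (v - x0)"
    \<comment> \<open>The combination of \<open>v\<close> and \<open>x0\<close> with weight 1/r lies
      on the unit sphere around \<open>x0\<close>, where \<open>M\<close> bounds \<open>h\<close>
      from below. The quadratic gain c (1 - c) r^2 equals r - 1, which limits r.\<close>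
    define c where "c = 1 / r"
    have r: "r > 1" using False by (simp add: r_def)
    have c: "c \<in> {0<..<1}" using r by (simp add: c_def)
    have "h v \<le> ereal m0" "h v \<noteq> -\<infinity>" using that assms(1) by (auto simp: K_def proper_fun_def)
    then obtain s where s: "h v = ereal s" "s \<le> m0" by (cases "h v") auto
    have "dist x0 (c *\<^sub>R v + (1 - c) *\<^sub>R x0) = norm (c *\<^sub>R (v - x0))"
      by (simp add: dist_norm norm_minus_commute algebra_simps)
    also have "\<dots> = 1" using r by (auto simp: c_def r_def)
    finally have "ereal M \<le> h (c *\<^sub>R v + (1 - c) *\<^sub>R x0)" using b(2) M by force
    also have "\<dots> \<le> ereal c * h v + ereal (1 - c) * h x0 - ereal (\<sigma> / 2 * c * (1 - c) * (norm (v - x0))\<^sup>2)"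
      using sc c by (auto simp: strongly_convex_fun_def)
    finally have "M \<le> c * s + (1 - c) * m0 - \<sigma> / 2 * c * (1 - c) * r\<^sup>2"
      by (simp add: s x0 r_def)
    also have "c * s \<le> c * m0" using c s by (intro mult_left_mono) auto
    also have "\<sigma> / 2 * c * (1 - c) * r\<^sup>2 = \<sigma> / 2 * (r - 1)"
      using r by (simp add: c_def field_simps power2_eq_square)
    finally have "\<sigma> / 2 * (r - 1) \<le> m0 - M" by (simp add: algebra_simps)
    then show ?thesis using \<open>0 < \<sigma>\<close> by (simp add: r_def field_simps)
  qed
  have "bounded K"
    unfolding bounded_def by (rule exI[of _ x0]) (use bd in \<open>auto simp: dist_norm norm_minus_commute intro!: exI\<close>)
  moreover have "closed K" unfolding K_def by (rule closed_fun_level[OF assms(2)])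
  moreover have "x0 \<in> K" by (simp add: K_def x0)
  ultimately obtain x where x: "x \<in> K" "\<And>v. v \<in> K \<Longrightarrow> h x \<le> h v"
    using closed_fun_attains_min[OF assms(2), of K] by (auto simp: compact_eq_bounded_closed)
  have "h x \<le> h v" for v
    using x by (cases "v \<in> K") (auto simp: K_def)
  moreover have "\<bar>h x\<bar> \<noteq> \<infinity>"
    using x(1) assms(1) by (auto simp: K_def proper_fun_def)
  ultimately show ?thesis by (metis ereal_real')
qed

text \<open>Modulus 0 lets the merely convex \<open>g\<close> enter
  \<open>strongly_convex_fun_add\<close>, where a quadratic term then supplies the whole
  modulus.\<close>

lemma convex_fun_strongly_convex_0:
  assumes "proper_fun h" "convex_fun h" shows "strongly_convex_fun 0 h"
  unfolding strongly_convex_fun_def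
proof (intro allI ballI)
  fix x y :: 'a and c :: real assume c: "c \<in> {0<..<1}"
  have nm: "h x \<noteq> -\<infinity>" "h y \<noteq> -\<infinity>" using assms(1) by (auto simp: proper_fun_def)
  show "h (c *\<^sub>R x + (1 - c) *\<^sub>R y)
     \<le> ereal c * h x + ereal (1 - c) * h y - ereal (0 / 2 * c * (1 - c) * (norm (x - y))\<^sup>2)"
  proof (cases "h x = \<infinity> \<or> h y = \<infinity>")
    case True
    then show ?thesis using c nm by (cases "h x"; cases "h y") auto
  next
    case False
    then obtain r s where rs: "h x = ereal r" "h y = ereal s" using nm by (metis ereal_cases)
    then have "(x, r) \<in> epi h" "(y, s) \<in> epi h" by (auto simp: epi_def)
    then have "c *\<^sub>R (x, r) + (1 - c) *\<^sub>R (y, s) \<in> epi h"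
      using assms(2) c unfolding convex_fun_def by (intro convexD) auto
    then show ?thesis by (simp add: epi_def rs)
  qed
qed

lemma strongly_convex_fun_add:
  fixes h :: "'a::euclidean_space \<Rightarrow> ereal" and \<phi> :: "'a \<Rightarrow> real"
  assumes "proper_fun h" "strongly_convex_fun \<sigma> h"
    and \<phi>: "\<And>x y c. c \<in> {0<..<1} \<Longrightarrow>
      \<phi> (c *\<^sub>R x + (1 - c) *\<^sub>R y) \<le> c * \<phi> x + (1 - c) * \<phi> y - \<mu> / 2 * c * (1 - c) * (norm (x - y))\<^sup>2"
  shows "strongly_convex_fun (\<sigma> + \<mu>) (\<lambda>x. h x + ereal (\<phi> x))"
  unfolding strongly_convex_fun_def
proof (intro allI ballI)
  fix x y :: 'a and c :: real assume c: "c \<in> {0<..<1}"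
  define u where "u = c *\<^sub>R x + (1 - c) *\<^sub>R y"
  have nm: "h x \<noteq> -\<infinity>" "h y \<noteq> -\<infinity>" "h u \<noteq> -\<infinity>" using assms(1) by (auto simp: proper_fun_def)
  have hu: "h u \<le> ereal c * h x + ereal (1 - c) * h y - ereal (\<sigma> / 2 * c * (1 - c) * (norm (x - y))\<^sup>2)"
    using assms(2) c by (auto simp: strongly_convex_fun_def u_def)
  have "h u + ereal (\<phi> u)
     \<le> ereal c * (h x + ereal (\<phi> x)) + ereal (1 - c) * (h y + ereal (\<phi> y)) - ereal ((\<sigma> + \<mu>) / 2 * c * (1 - c) * (norm (x - y))\<^sup>2)"
  proof (cases "h x = \<infinity> \<or> h y = \<infinity>")
    case True
    then show ?thesis using c nm by (cases "h x"; cases "h y") auto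
  next
    case False
    then obtain r s where rs: "h x = ereal r" "h y = ereal s" using nm by (metis ereal_cases)
    with hu nm obtain q where q: "h u = ereal q" by (cases "h u") auto
    show ?thesis using hu \<phi>[OF c, of x y] unfolding u_def[symmetric]
      by (simp add: rs q algebra_simps add_divide_distrib)
  qed
  then show "h (c *\<^sub>R x + (1 - c) *\<^sub>R y) + ereal (\<phi> (c *\<^sub>R x + (1 - c) *\<^sub>R y))
     \<le> ereal c * (h x + ereal (\<phi> x)) + ereal (1 - c) * (h y + ereal (\<phi> y))
       - ereal ((\<sigma> + \<mu>) / 2 * c * (1 - c) * (norm (x - y))\<^sup>2)"
    by (simp add: u_def)
qed

lemma proper_fun_add:
  assumes "proper_fun h" shows "proper_fun (\<lambda>x. h x + ereal (\<phi> x))"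
  using assms by (auto simp: proper_fun_def)

lemma closed_fun_add:
  fixes h :: "'a::euclidean_space \<Rightarrow> ereal"
  assumes "closed_fun h" "continuous_on UNIV \<phi>"
  shows "closed_fun (\<lambda>x. h x + ereal (\<phi> x))"
proof -
  have "h x + ereal (\<phi> x) \<le> ereal r \<longleftrightarrow> h x \<le> ereal (r - \<phi> x)" for x r
    by (cases "h x") auto
  then have "epi (\<lambda>x. h x + ereal (\<phi> x)) = (\<lambda>(x, r). (x, r - \<phi> x)) -` epi h"
    by (auto simp: epi_def)
  moreover have "closed ((\<lambda>(x, r). (x, r - \<phi> x)) -` epi h)"
    using assms unfolding closed_fun_def case_prod_beta
    by (intro closed_vimage continuous_intros continuous_on_compose2[OF assms(2)]) simp_all
  ultimately show ?thesis by (simp add: closed_fun_def)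
qed

section \<open>The momentum recursion\<close>

lemma norm_sum_power2: "(norm (x + c *\<^sub>R d))\<^sup>2 = (norm x)\<^sup>2 + 2 * c * (x \<bullet> d) + c\<^sup>2 * (norm d)\<^sup>2"
  for x d :: "'a::real_inner"
  by (simp only: power2_norm_eq_inner) (simp add: algebra_simps inner_commute power2_eq_square)

locale momentum =
  fixes L t T v :: "nat \<Rightarrow> real" and y w :: "nat \<Rightarrow> 'a::real_inner" and ystar :: 'a
  assumes T_def: "\<And>k. T k = (\<Sum>i\<le>k. t i)"
    and L_pos: "0 < L 0" and L_mono: "\<And>j. L j \<le> L (Suc j)"
    and t_pos: "\<And>j. 0 < t j" and t_le: "\<And>j. (t j)\<^sup>2 \<le> T j"
    and w0: "w 0 = y 0"
    and w_Suc: "\<And>j. w (Suc j) = y (Suc j)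
           + ((T j - t j) * t (Suc j) / (t j * T (Suc j))) *\<^sub>R (y (Suc j) - y j)
           + (((t j)\<^sup>2 - T j) * t (Suc j) / (t j * T (Suc j))) *\<^sub>R (y (Suc j) - w j)"
    and v_nonneg: "\<And>j. 0 \<le> v (Suc j)"
    and step_star: "\<And>j. v (Suc j) \<le> - L (Suc j) * ((norm (y (Suc j) - w j))\<^sup>2 / 2 + (w j - ystar) \<bullet> (y (Suc j) - w j))"
    and step_prev: "\<And>j. v (Suc (Suc j)) \<le> v (Suc j)
           - L (Suc (Suc j)) * ((norm (y (Suc (Suc j)) - w (Suc j)))\<^sup>2 / 2 + (w (Suc j) - y (Suc j)) \<bullet> (y (Suc (Suc j)) - w (Suc j)))"
begin

definition aux :: "nat \<Rightarrow> 'a" where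
  "aux j = (1 / t j) *\<^sub>R (T j *\<^sub>R w j - (T j - t j) *\<^sub>R y j)"

definition lyapunov :: "nat \<Rightarrow> real" where
  "lyapunov j = 2 * (T j - t j) / L j * v j + (norm (aux j - ystar))\<^sup>2"

lemma L_pos': "0 < L j"
  by (induction j) (auto intro: L_pos less_le_trans[OF _ L_mono])

lemma T_Suc: "T (Suc j) = T j + t (Suc j)" and T_0: "T 0 = t 0"
  by (simp_all add: T_def)

lemma T_ge: "t j \<le> T j" and T_pos: "0 < T j"
proof -
  have "0 \<le> T j" for j unfolding T_def using t_pos by (intro sum_nonneg) (auto intro: less_imp_le)
  then show "t j \<le> T j" by (cases j) (auto simp: T_Suc T_0)
  with t_pos[of j] show "0 < T j" by linarith
qed

text \<open>This identity explains the momentum coefficients: their common factor t/T at the new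
  index cancels in \<open>aux\<close>, and the coefficients of \<open>y (Suc j)\<close> then add up
  to \<open>t j\<close>.\<close>

lemma aux_Suc: "aux (Suc j) = aux j + t j *\<^sub>R (y (Suc j) - w j)"
proof -
  have nz: "t j \<noteq> 0" "t (Suc j) \<noteq> 0" "T (Suc j) \<noteq> 0" using t_pos T_pos by (metis less_irrefl)+
  have "T (Suc j) *\<^sub>R w (Suc j) = T (Suc j) *\<^sub>R y (Suc j)
      + t (Suc j) *\<^sub>R (((T j - t j) / t j) *\<^sub>R (y (Suc j) - y j) + (((t j)\<^sup>2 - T j) / t j) *\<^sub>R (y (Suc j) - w j))"
    using nz by (simp add: w_Suc scaleR_right_distrib mult.commute)
  then have "aux (Suc j) = y (Suc j) + ((T j - t j) / t j) *\<^sub>R (y (Suc j) - y j) + (((t j)\<^sup>2 - T j) / t j) *\<^sub>R (y (Suc j) - w j)"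
    unfolding aux_def using nz by (simp add: T_Suc scaleR_left_distrib scaleR_right_distrib)
  also have "\<dots> = aux j + t j *\<^sub>R (y (Suc j) - w j)"
    unfolding aux_def using nz
    by (simp add: scaleR_diff_right scaleR_diff_left scaleR_right_distrib diff_divide_distrib power2_eq_square)
  finally show ?thesis .
qed

text \<open>\<open>step_star\<close> is taken with weight t and \<open>step_prev\<close> with weight
  T - t. Since T w = (T - t) y + t aux, the inner products merge into the cross term of the expanded
  square of the new \<open>aux - ystar\<close>. The inequalities supply T times the squared
  residual, the square consumes t^2 of it.\<close>

lemma lyapunov_step:
  "lyapunov (Suc j) + (T j - (t j)\<^sup>2) * (norm (y (Suc j) - w j))\<^sup>2 \<le> lyapunov j"
proof -
  define \<delta> where "\<delta> = y (Suc j) - w j"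
  define Lj where "Lj = L (Suc j)"
  have Lj: "0 < Lj" using L_pos' by (simp add: Lj_def)
  have nz: "t j \<noteq> 0" using t_pos[of j] by simp
  have "T j *\<^sub>R w j = (T j - t j) *\<^sub>R y j + t j *\<^sub>R aux j" unfolding aux_def using nz by simp
  then have comb: "(T j - t j) * ((w j - y j) \<bullet> \<delta>) + t j * ((w j - ystar) \<bullet> \<delta>) = t j * ((aux j - ystar) \<bullet> \<delta>)"
    by (simp add: inner_diff_left algebra_simps flip: inner_scaleR_left inner_add_left)
  have 1: "t j * v (Suc j) \<le> t j * (- Lj * ((norm \<delta>)\<^sup>2 / 2 + (w j - ystar) \<bullet> \<delta>))"
    using step_star[of j] t_pos[of j] unfolding \<delta>_def Lj_def by (intro mult_left_mono) auto
  have 2: "(T j - t j) * v (Suc j) \<le> (T j - t j) * (v j - Lj * ((norm \<delta>)\<^sup>2 / 2 + (w j - y j) \<bullet> \<delta>))"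
  proof (cases j)
    case 0 then show ?thesis by (simp add: T_0)
  next
    case (Suc i)
    show ?thesis using step_prev[of i] T_ge[of j] unfolding \<delta>_def Lj_def Suc by (intro mult_left_mono) auto
  qed
  have "T j * v (Suc j) \<le> (T j - t j) * v j - Lj * (T j * (norm \<delta>)\<^sup>2 / 2
      + ((T j - t j) * ((w j - y j) \<bullet> \<delta>) + t j * ((w j - ystar) \<bullet> \<delta>)))"
    using add_mono[OF 1 2] by (simp add: algebra_simps diff_divide_distrib)
  then have "T j * v (Suc j) \<le> (T j - t j) * v j - Lj * (T j * (norm \<delta>)\<^sup>2 / 2 + t j * ((aux j - ystar) \<bullet> \<delta>))"
    unfolding comb .
  then have "2 / Lj * (T j * v (Suc j))
      \<le> 2 / Lj * ((T j - t j) * v j - Lj * (T j * (norm \<delta>)\<^sup>2 / 2 + t j * ((aux j - ystar) \<bullet> \<delta>)))"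
    using Lj by (intro mult_left_mono) auto
  also have "\<dots> = 2 * (T j - t j) / Lj * v j - (T j * (norm \<delta>)\<^sup>2 + 2 * t j * ((aux j - ystar) \<bullet> \<delta>))"
    using Lj by (simp add: right_diff_distrib distrib_left)
  finally have "2 * T j / Lj * v (Suc j) + (T j * (norm \<delta>)\<^sup>2 + 2 * t j * ((aux j - ystar) \<bullet> \<delta>)) \<le> 2 * (T j - t j) / Lj * v j"
    by simp
  \<comment> \<open>Monotonicity of \<open>L\<close> enters here, with \<open>v j\<close>
    nonnegative. At j = 0 the weight T - t is 0, so the unconstrained \<open>v 0\<close> drops
    out.\<close>
  also have "\<dots> \<le> 2 * (T j - t j) / L j * v j"
  proof (cases j)
    case 0 then show ?thesis by (simp add: T_0)
  next
    case (Suc i)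
    then have "0 \<le> v j" using v_nonneg by simp
    then show ?thesis using L_mono[of j] L_pos'[of j] T_ge[of j] unfolding Lj_def
      by (intro mult_right_mono divide_left_mono) auto
  qed
  finally show ?thesis
    unfolding lyapunov_def aux_Suc \<delta>_def[symmetric] Lj_def[symmetric]
      norm_sum_power2[of "aux j - ystar" "t j" \<delta>, simplified diff_add_eq]
    by (simp add: T_Suc algebra_simps)
qed

lemma lyapunov_sum:
  "lyapunov k + (\<Sum>j<k. (T j - (t j)\<^sup>2) * (norm (y (Suc j) - w j))\<^sup>2) \<le> (norm (y 0 - ystar))\<^sup>2"
proof (induction k)
  case 0
  \<comment> \<open>With T 0 = t 0 the value term vanishes and only the initial squared distance
    remains.\<close>
  have "aux 0 = y 0" using t_pos[of 0] by (simp add: aux_def T_0 w0)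
  then show ?case by (simp add: lyapunov_def T_0)
next
  case (Suc k)
  then show ?case using lyapunov_step[of k] by simp
qed

lemma value_nonneg: "0 \<le> 2 * (T j - t j) / L j * v j"
  using v_nonneg[of "j - 1"] T_ge[of j] L_pos'[of j] by (cases j) (simp_all add: T_0)

lemma aux_bounded: "norm (aux k - ystar) \<le> norm (y 0 - ystar)"
proof -
  have "0 \<le> (\<Sum>j<k. (T j - (t j)\<^sup>2) * (norm (y (Suc j) - w j))\<^sup>2)"
    using t_le by (intro sum_nonneg) simp
  then have "(norm (aux k - ystar))\<^sup>2 \<le> (norm (y 0 - ystar))\<^sup>2"
    using lyapunov_sum[of k] value_nonneg[of k] unfolding lyapunov_def by linarith
  then show ?thesis by (rule power2_le_imp_le) simp
qed

text \<open>Twice the bracket in \<open>step_star\<close> is the change of the squared distance to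
  \<open>ystar\<close> from \<open>w j\<close> to \<open>y (Suc j)\<close>; nonnegativity of
  \<open>v\<close> forces it to be at most 0.\<close>

lemma fejer: "norm (y (Suc j) - ystar) \<le> norm (w j - ystar)"
proof -
  have "0 \<le> - L (Suc j) * ((norm (y (Suc j) - w j))\<^sup>2 / 2 + (w j - ystar) \<bullet> (y (Suc j) - w j))"
    using v_nonneg[of j] step_star[of j] by linarith
  then have "(norm (y (Suc j) - w j))\<^sup>2 / 2 + (w j - ystar) \<bullet> (y (Suc j) - w j) \<le> 0"
    using L_pos'[of "Suc j"] by (simp add: mult_le_0_iff zero_le_mult_iff)
  then have "(norm (y (Suc j) - ystar))\<^sup>2 \<le> (norm (w j - ystar))\<^sup>2"
    using norm_sum_power2[of "w j - ystar" 1 "y (Suc j) - w j"] by simp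
  then show ?thesis by (rule power2_le_imp_le) simp
qed

text \<open>The auxiliary points stay in the ball around the solution; each w is a convex combination of
  the preceding y and aux, and passing from w to the next y does not increase the distance.\<close>
lemma iterates_bounded: "norm (y k - ystar) \<le> norm (y 0 - ystar)"
proof (induction k)
  case (Suc k)
  have Tk: "0 < T k" by (rule T_pos)
  have "T k *\<^sub>R (w k - ystar) = (T k - t k) *\<^sub>R (y k - ystar) + t k *\<^sub>R (aux k - ystar)"
    unfolding aux_def using t_pos[of k] by (simp add: algebra_simps)
  then have "T k * norm (w k - ystar) \<le> (T k - t k) * norm (y k - ystar) + t k * norm (aux k - ystar)"
    using norm_triangle_ineq[of "(T k - t k) *\<^sub>R (y k - ystar)" "t k *\<^sub>R (aux k - ystar)"]
      T_ge[of k] t_pos[of k] Tk by (metis norm_scaleR abs_of_nonneg abs_of_pos diff_ge_0_iff_ge)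
  also have "\<dots> \<le> (T k - t k) * norm (y 0 - ystar) + t k * norm (y 0 - ystar)"
    using Suc aux_bounded T_ge[of k] t_pos[of k] by (intro add_mono mult_left_mono) (auto intro: less_imp_le)
  also have "\<dots> = T k * norm (y 0 - ystar)" by (simp add: algebra_simps)
  finally show ?case using Tk fejer[of k] by simp
qed simp

text \<open>The hypothesis on \<open>v (Suc k)\<close> is what a further proximal step from
  \<open>y (Suc k)\<close> with residual at least \<open>D\<close> provides. It turns the value term
  of the Lyapunov function, whose weight is 2 T k / L (Suc k), into T k times D^2.\<close>

lemma residual_bound:
  assumes "\<And>j. j < Suc k \<Longrightarrow> D \<le> norm (y (Suc j) - w j)" "0 \<le> D" "L (Suc k) * D\<^sup>2 / 2 \<le> v (Suc k)"
  shows "D\<^sup>2 * (T k + (\<Sum>j\<le>k. T j - (t j)\<^sup>2)) \<le> (norm (y 0 - ystar))\<^sup>2"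
proof -
  have Lk: "0 < L (Suc k)" by (rule L_pos')
  have "T k * D\<^sup>2 = 2 * T k / L (Suc k) * (L (Suc k) * D\<^sup>2 / 2)" using Lk by simp
  also have "\<dots> \<le> 2 * T k / L (Suc k) * v (Suc k)"
    using assms(3) Lk T_pos[of k] by (intro mult_left_mono) auto
  also have "\<dots> \<le> lyapunov (Suc k)" by (simp add: lyapunov_def T_Suc)
  finally have 1: "T k * D\<^sup>2 \<le> lyapunov (Suc k)" .
  have "(\<Sum>j\<le>k. (T j - (t j)\<^sup>2) * D\<^sup>2) \<le> (\<Sum>j<Suc k. (T j - (t j)\<^sup>2) * (norm (y (Suc j) - w j))\<^sup>2)"
    unfolding lessThan_Suc_atMost using assms t_le by (intro sum_mono mult_left_mono power_mono) auto
  with 1 lyapunov_sum[of "Suc k"] show ?thesis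
    by (simp add: algebra_simps sum_distrib_left del: sum.lessThan_Suc)
qed

end

section \<open>Cubic growth of the accumulated weights for linear step sizes\<close>

lemma sum_linear_stepsizes:
  fixes a :: real assumes "a > 0"
  shows "(\<Sum>i\<le>k. (real i + a) / a) = (real k + 1) * (real k + 2 * a) / (2 * a)"
  using assms by (induction k) (auto simp: field_simps)

lemma linear_stepsizes_weight:
  fixes a :: real assumes "a > 2"
  defines "t \<equiv> \<lambda>i. (real i + a) / a"
  shows "(a - 2) * (real k + 1) ^ 3 / (6 * a\<^sup>2) \<le> (\<Sum>i\<le>k. t i) + (\<Sum>j\<le>k. (\<Sum>i\<le>j. t i) - (t j)\<^sup>2)"
proof -
  have a: "a > 0" using assms by simp
  have weight: "(\<Sum>i\<le>j. t i) - (t j)\<^sup>2 = ((a - 2) * (real j)\<^sup>2 + a * (2 * a - 3) * real j) / (2 * a\<^sup>2)" for j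
    unfolding t_def sum_linear_stepsizes[OF a] using a by (simp add: field_simps power2_eq_square)
  have S: "(\<Sum>j\<le>k. (a - 2) * (real j)\<^sup>2 + a * (2 * a - 3) * real j)
     = (a - 2) * (real k * (real k + 1) * (2 * real k + 1) / 6) + a * (2 * a - 3) * (real k * (real k + 1) / 2)"
    by (induction k) (auto simp: field_simps power2_eq_square)
  have "(\<Sum>i\<le>k. t i) + (\<Sum>j\<le>k. (\<Sum>i\<le>j. t i) - (t j)\<^sup>2)
    = (6 * a * ((real k + 1) * (real k + 2 * a)) + (a - 2) * (real k * (real k + 1) * (2 * real k + 1))
        + 3 * a * (2 * a - 3) * (real k * (real k + 1))) * 2 / (6 * a\<^sup>2) / 4"
    unfolding weight sum_divide_distrib[symmetric] S
    unfolding t_def sum_linear_stepsizes[OF a] using a by (simp add: field_simps power2_eq_square)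
  moreover have "(a - 2) * (real k + 1) ^ 3 * 2 \<le> 6 * a * ((real k + 1) * (real k + 2 * a)) + (a - 2) * (real k * (real k + 1) * (2 * real k + 1))
        + 3 * a * (2 * a - 3) * (real k * (real k + 1))"
  proof -
    \<comment> \<open>In terms of \<open>b\<close> > 0 the difference of the two sides is a
      polynomial in \<open>b\<close> and \<open>k\<close> with nonnegative coefficients; the cubic
      terms in \<open>k\<close> cancel.\<close>
    define b where "b = a - 2"
    have ab: "a = b + 2" and b: "b > 0" using assms by (simp_all add: b_def)
    have "0 \<le> 6 * a * ((real k + 1) * (real k + 2 * a)) + (a - 2) * (real k * (real k + 1) * (2 * real k + 1))
        + 3 * a * (2 * a - 3) * (real k * (real k + 1)) - (a - 2) * (real k + 1) ^ 3 * 2"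
      unfolding ab using b by (simp add: algebra_simps power3_eq_cube power2_eq_square)
    then show ?thesis by simp
  qed
  ultimately show ?thesis using a by (simp add: divide_simps)
qed

section \<open>The dual problem\<close>

lemma gderiv_unique:
  assumes "GDERIV h x :> d" "GDERIV h x :> e" shows "d = e"
proof -
  have "(\<lambda>v. v \<bullet> d) = (\<lambda>v. v \<bullet> e)"
    using assms unfolding gderiv_def by (rule has_derivative_unique)
  then show ?thesis by (metis vector_eq_rdot inner_commute)
qed

lemma gderiv_quadratic_bound:
  fixes h :: "'a::real_inner \<Rightarrow> real"
  assumes "\<And>v. \<bar>h v - h x - (v - x) \<bullet> d\<bar> \<le> K * (norm (v - x))\<^sup>2"
  shows "GDERIV h x :> d"
  unfolding gderiv_def has_derivative_at
proof
  show "bounded_linear (\<lambda>v. v \<bullet> d)" by (rule bounded_linear_inner_left)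
  have "((\<lambda>v::'a. K * norm v) \<longlongrightarrow> K * norm (0::'a)) (at 0)" by (intro tendsto_intros)
  then have lim: "((\<lambda>v::'a. K * norm v) \<longlongrightarrow> 0) (at 0)" by simp
  show "(\<lambda>v. norm (h (x + v) - h x - v \<bullet> d) / norm v) \<midarrow>0\<rightarrow> 0"
  proof (rule tendsto_sandwich[OF _ _ tendsto_const lim])
    have "norm (h (x + v) - h x - v \<bullet> d) / norm v \<le> K * norm v" if "v \<noteq> 0" for v
      using assms[of "x + v"] that by (simp add: pos_divide_le_eq power2_eq_square mult.assoc)
    then show "eventually (\<lambda>v. norm (h (x + v) - h x - v \<bullet> d) / norm v \<le> K * norm v) (at 0)"
      by (auto simp: eventually_at_filter)
  qed simp
qed

locale dual_problem =
  fixes f :: "real^'n \<Rightarrow> ereal" and g :: "real^'m \<Rightarrow> ereal"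
    and A :: "real^'n^'m" and \<sigma> :: real
  assumes f_proper: "proper_fun f" and f_closed: "closed_fun f"
    and g_proper: "proper_fun g" and g_closed: "closed_fun g" and g_convex: "convex_fun g"
    and \<sigma>_pos: "0 < \<sigma>" and f_strongly_convex: "strongly_convex_fun \<sigma> f"
begin

text \<open>The point A x(y) is the gradient of F at y, as \<open>grad_rF\<close> confirms.\<close>

definition AX :: "real^'m \<Rightarrow> real^'m" where
  "AX y = A *v primal_x f A y"

definition fX :: "real^'m \<Rightarrow> real" where
  "fX y = real_of_ereal (f (primal_x f A y))"

definition rF :: "real^'m \<Rightarrow> real" where
  "rF y = y \<bullet> AX y - fX y"

text \<open>x(y) minimizes f tilted by a linear function, which is still strongly convex. Existence
  of one minimizer makes the point chosen by \<open>arg_max\<close> a minimizer, and quadratic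
  growth around it is all that is used about x(y) later.\<close>

lemma primal_x_growth:
  shows f_primal_x: "f (primal_x f A y) = ereal (fX y)"
    and f_ge: "ereal (fX y + y \<bullet> (A *v v - AX y) + \<sigma> / 2 * (norm (v - primal_x f A y))\<^sup>2) \<le> f v"
proof -
  define u where "u = transpose A *v y"
  define h where "h = (\<lambda>x. f x + ereal (- (u \<bullet> x)))"
  have neg: "ereal (u \<bullet> x) - f x = - h x" for x
    unfolding h_def by (cases "f x") auto
  have h: "proper_fun h" "closed_fun h" "strongly_convex_fun (\<sigma> + 0) h"
    unfolding h_def using f_proper f_closed f_strongly_convex
    by (intro proper_fun_add closed_fun_add strongly_convex_fun_add continuous_intros;
        simp add: inner_add_right)+
  obtain x0 m where x0: "h x0 = ereal m" "\<And>v. h x0 \<le> h v"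
    using strongly_convex_fun_has_min[OF h(1,2) \<sigma>_pos] h(3) by auto
  have "is_arg_max (\<lambda>x. ereal (u \<bullet> x) - f x) (\<lambda>_. True) x0"
    unfolding is_arg_max_linorder neg by (simp only: ereal_minus_le_minus x0(2) simp_thms)
  then have "is_arg_max (\<lambda>x. ereal (u \<bullet> x) - f x) (\<lambda>_. True) (primal_x f A y)"
    unfolding primal_x_def arg_max_def u_def by (rule someI)
  then have min: "h (primal_x f A y) \<le> h v" for v
    unfolding is_arg_max_linorder neg ereal_minus_le_minus by blast
  then have hX: "h (primal_x f A y) = ereal m"
    using x0 by (metis antisym)
  then show fXy: "f (primal_x f A y) = ereal (fX y)"
    unfolding h_def fX_def by (cases "f (primal_x f A y)") auto
  have m: "m = fX y - y \<bullet> AX y"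
    using hX unfolding h_def fXy by (simp add: u_def dot_lmul_matrix AX_def)
  show "ereal (fX y + y \<bullet> (A *v v - AX y) + \<sigma> / 2 * (norm (v - primal_x f A y))\<^sup>2) \<le> f v"
    using strongly_convex_fun_growth[OF h(3) hX min, of v]
    unfolding h_def m by (cases "f v") (auto simp: u_def dot_lmul_matrix inner_diff_right)
qed

lemma dual_F_eq: "dual_F f A y = ereal (rF y)"
proof (rule antisym)
  show "dual_F f A y \<le> ereal (rF y)"
    unfolding dual_F_def conj_fun_def
  proof (rule SUP_least)
    fix x
    have "0 \<le> \<sigma> / 2 * (norm (x - primal_x f A y))\<^sup>2" using \<sigma>_pos by simp
    then show "ereal ((transpose A *v y) \<bullet> x) - f x \<le> ereal (rF y)"
      using f_ge[of y x] by (cases "f x") (auto simp: rF_def dot_lmul_matrix inner_diff_right)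
  qed
  show "ereal (rF y) \<le> dual_F f A y"
    unfolding dual_F_def conj_fun_def
    by (rule SUP_upper2[of "primal_x f A y"]) (auto simp: f_primal_x rF_def AX_def dot_lmul_matrix)
qed

text \<open>The growth inequality around x(v) is tested at x(y). Keeping the quadratic gain is what
  yields the Lipschitz constant below.\<close>

lemma rF_lower_strong:
  "rF y + (v - y) \<bullet> AX y + \<sigma> / 2 * (norm (primal_x f A y - primal_x f A v))\<^sup>2 \<le> rF v"
  using f_ge[of v "primal_x f A y"] unfolding f_primal_x
  by (simp add: rF_def AX_def[of y, symmetric] inner_diff_right inner_diff_left)

lemma rF_lower: "rF y + (v - y) \<bullet> AX y \<le> rF v"
proof -
  have "0 \<le> \<sigma> / 2 * (norm (primal_x f A y - primal_x f A v))\<^sup>2" using \<sigma>_pos by simp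
  with rF_lower_strong[of y v] show ?thesis by linarith
qed

lemma lip_F_nonneg: "0 \<le> lip_F \<sigma> A"
  using \<sigma>_pos by (simp add: lip_F_def)

text \<open>Adding \<open>rF_lower_strong\<close> to itself with the points swapped gives \<sigma>
  |d|^2 \<le> (v - y) \<bullet> A d. Cancelling |d| costs one factor of the operator norm, and
  mapping d by A costs the second.\<close>

lemma AX_lipschitz: "norm (AX v - AX y) \<le> lip_F \<sigma> A * norm (v - y)"
proof -
  define d where "d = primal_x f A v - primal_x f A y"
  define N where "N = onorm ((*v) A)"
  have N: "norm (A *v x) \<le> N * norm x" for x
    unfolding N_def by (rule onorm) simp
  have N0: "0 \<le> N" unfolding N_def by (rule onorm_pos_le) simp
  have Ad: "AX v - AX y = A *v d" by (simp add: AX_def d_def matrix_vector_mult_diff_distrib)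
  have nd: "norm (primal_x f A y - primal_x f A v) = norm d" "norm (primal_x f A v - primal_x f A y) = norm d"
    by (simp_all add: d_def norm_minus_commute)
  have "\<sigma> * (norm d)\<^sup>2 \<le> (v - y) \<bullet> (A *v d)"
    using rF_lower_strong[of y v] rF_lower_strong[of v y] unfolding nd Ad[symmetric]
    by (simp add: inner_diff_left inner_diff_right)
  also have "\<dots> \<le> norm (v - y) * norm (A *v d)" by (rule norm_cauchy_schwarz)
  also have "\<dots> \<le> norm (v - y) * (N * norm d)" using N by (intro mult_left_mono) auto
  finally have "\<sigma> * norm d * norm d \<le> N * norm (v - y) * norm d"
    by (simp add: power2_eq_square mult_ac)
  then have "\<sigma> * norm d \<le> N * norm (v - y)"
    using N0 by (cases "norm d = 0") auto
  then have "norm d \<le> N * norm (v - y) / \<sigma>" using \<sigma>_pos by (simp add: pos_le_divide_eq mult.commute)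
  then have "N * norm d \<le> N * (N * norm (v - y) / \<sigma>)" using N0 by (rule mult_left_mono)
  with N[of d] show ?thesis
    unfolding Ad lip_F_def N_def[symmetric] by (simp add: power2_eq_square)
qed

text \<open>The gradient inequalities based at \<open>w\<close> and at \<open>v\<close> enclose the
  linearization error between 0 and a quadratic, the upper end by the Lipschitz bound on
  \<open>AX\<close>.\<close>

lemma grad_rF: "grad rF w = AX w"
proof -
  have "GDERIV rF w :> AX w"
  proof (rule gderiv_quadratic_bound)
    fix v
    have "rF v - rF w - (v - w) \<bullet> AX w \<le> (v - w) \<bullet> (AX v - AX w)"
      using rF_lower[of v w] by (simp add: inner_diff_left inner_diff_right)
    also have "\<dots> \<le> norm (v - w) * norm (AX v - AX w)" by (rule norm_cauchy_schwarz)
    also have "\<dots> \<le> norm (v - w) * (lip_F \<sigma> A * norm (v - w))" by (intro mult_left_mono AX_lipschitz) simp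
    finally show "\<bar>rF v - rF w - (v - w) \<bullet> AX w\<bar> \<le> lip_F \<sigma> A * (norm (v - w))\<^sup>2"
      using rF_lower[of w v] by (simp add: power2_eq_square mult_ac)
  qed
  then show ?thesis
    unfolding grad_def by (blast intro: gderiv_unique)
qed

lemma dual_Q_eq:
  "dual_Q f g A L y w = ereal (rF w + ((y - w) \<bullet> AX w + L / 2 * (norm (y - w))\<^sup>2)) + dual_G g y"
  by (simp add: dual_Q_def dual_F_eq grad_rF)

section \<open>Dual values and the dual proximal step\<close>

lemma dual_G_ge:
  assumes "g z = ereal c" shows "ereal (- (v \<bullet> z) - c) \<le> dual_G g v"
  unfolding dual_G_def conj_fun_def using assms by (intro SUP_upper2[of z]) auto

text \<open>The second hypothesis says that \<open>- y\<close> is a subgradient of \<open>g\<close>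
  at \<open>z\<close>, the equality case of Fenchel's inequality. It is the form in which minimizers
  z(y) are certified from here on.\<close>

lemma dual_G_eq:
  assumes "g z = ereal c" "\<And>u. ereal (c - y \<bullet> (u - z)) \<le> g u"
  shows "dual_G g y = ereal (- (y \<bullet> z) - c)"
proof (rule antisym[OF _ dual_G_ge[OF assms(1)]])
  show "dual_G g y \<le> ereal (- (y \<bullet> z) - c)"
    unfolding dual_G_def conj_fun_def
  proof (rule SUP_least)
    fix u show "ereal (- y \<bullet> u) - g u \<le> ereal (- (y \<bullet> z) - c)"
      using assms(2)[of u] by (cases "g u") (auto simp: inner_diff_right)
  qed
qed

text \<open>Testing the infimum at (x(v), z) bounds q by a real number at every \<open>v\<close>,
  even where q is -\<infinity>. At points with a subgradient certificate the bound is attained, so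
  extended-real subtraction of F and G is avoided.\<close>

lemma dual_q_le:
  assumes "g z = ereal c" shows "dual_q f g A v \<le> ereal (- rF v + v \<bullet> z + c)"
  unfolding dual_q_def
  by (rule INF_lower2[of "(primal_x f A v, z)"])
     (auto simp: primal_Ht_def f_primal_x assms rF_def AX_def inner_diff_right)

lemma dual_q_eq:
  assumes "g z = ereal c" "\<And>u. ereal (c - y \<bullet> (u - z)) \<le> g u"
  shows "dual_q f g A y = ereal (- rF y + y \<bullet> z + c)"
proof (rule antisym[OF dual_q_le[OF assms(1)]])
  show "ereal (- rF y + y \<bullet> z + c) \<le> dual_q f g A y"
    unfolding dual_q_def
  proof (rule INF_greatest, clarify)
    fix x u
    have "0 \<le> \<sigma> / 2 * (norm (x - primal_x f A y))\<^sup>2" using \<sigma>_pos by simp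
    then show "ereal (- rF y + y \<bullet> z + c) \<le> primal_Ht f g x u - ereal (y \<bullet> (A *v x - u))"
      using f_ge[of y x] assms(2)[of u] unfolding primal_Ht_def
      by (cases "f x"; cases "g u") (auto simp: rF_def inner_diff_right)
  qed
qed

lemma primal_z_setD:
  assumes "z \<in> primal_z_set g y"
  shows "\<exists>c. g z = ereal c \<and> (\<forall>u. ereal (c - y \<bullet> (u - z)) \<le> g u)"
proof -
  have min: "ereal (y \<bullet> z) + g z \<le> ereal (y \<bullet> u) + g u" for u
    using assms by (simp add: primal_z_set_def is_arg_min_linorder)
  obtain u0 where "g u0 \<noteq> \<infinity>" using g_proper by (auto simp: proper_fun_def)
  with min[of u0] have "g z \<noteq> \<infinity>" by (cases "g u0") auto
  moreover have "g z \<noteq> -\<infinity>" using g_proper by (simp add: proper_fun_def)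
  ultimately obtain c where c: "g z = ereal c" by (cases "g z") auto
  have "ereal (c - y \<bullet> (u - z)) \<le> g u" for u
    using min[of u] unfolding c by (cases "g u") (auto simp: inner_diff_right)
  with c show ?thesis by blast
qed

text \<open>The minimizers form the sublevel set of the tilted \<open>g\<close> at its minimum
  value. Closedness is what makes the closest point to A x(y) a minimizer.\<close>

lemma closed_primal_z_set: "closed (primal_z_set g y)"
proof (cases "primal_z_set g y = {}")
  case False
  then obtain z where z: "z \<in> primal_z_set g y" by blast
  then obtain c where c: "g z = ereal c" "\<And>u. ereal (c - y \<bullet> (u - z)) \<le> g u"
    using primal_z_setD by blast
  have min: "ereal (y \<bullet> z + c) \<le> ereal (y \<bullet> u) + g u" for u
    using c(2)[of u] by (cases "g u") (auto simp: inner_diff_right)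
  have "primal_z_set g y = {u. g u + ereal (y \<bullet> u) \<le> ereal (y \<bullet> z + c)}"
  proof safe
    fix u assume "u \<in> primal_z_set g y"
    then have "ereal (y \<bullet> u) + g u \<le> ereal (y \<bullet> z) + g z"
      by (simp add: primal_z_set_def is_arg_min_linorder)
    then show "g u + ereal (y \<bullet> u) \<le> ereal (y \<bullet> z + c)" by (simp add: c add.commute)
  next
    fix u assume "g u + ereal (y \<bullet> u) \<le> ereal (y \<bullet> z + c)"
    with min show "u \<in> primal_z_set g y"
      unfolding primal_z_set_def is_arg_min_linorder by (auto simp: add.commute intro: order_trans)
  qed
  also have "closed \<dots>"
    by (intro closed_fun_level closed_fun_add g_closed continuous_intros)
  finally show ?thesis .
qed simp

lemma norm_diff_power2: "(norm (u - c))\<^sup>2 = (norm (u - z))\<^sup>2 + 2 * ((u - z) \<bullet> (z - c)) + (norm (z - c))\<^sup>2"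
  for u z c :: "'a::real_inner"
  by (simp only: power2_norm_eq_inner) (simp add: algebra_simps inner_commute)

text \<open>The dual proximal step is the Moreau dual of a proximal step on g, whose minimizer provides
  both the dual minimizer and a primal z for it.\<close>
lemma prox_step_dual:
  assumes L: "0 < L"
  obtains z c where "z = AX w + L *\<^sub>R (prox_step f g A L w - w)" "g z = ereal c"
    "\<And>u. ereal (c - prox_step f g A L w \<bullet> (u - z)) \<le> g u"
proof -
  define a where "a = AX w"
  \<comment> \<open>Minimizing g + \<phi> is the proximal problem for \<open>g\<close>; its
    optimality condition makes -(w + (z - a) / L) a subgradient of \<open>g\<close> at
    \<open>z\<close>, hence the definition of \<open>y\<close> below.\<close>
  define \<phi> where "\<phi> z = w \<bullet> z + (norm (z - a))\<^sup>2 / (2 * L)" for z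
  define h where "h = (\<lambda>z. g z + ereal (\<phi> z))"
  have conv: "\<phi> (c *\<^sub>R x + (1 - c) *\<^sub>R y) \<le> c * \<phi> x + (1 - c) * \<phi> y - (1 / L) / 2 * c * (1 - c) * (norm (x - y))\<^sup>2"
    for x y and c :: real
  proof -
    have eq: "(norm (c *\<^sub>R x + (1 - c) *\<^sub>R y - a))\<^sup>2 = c * (norm (x - a))\<^sup>2 + (1 - c) * (norm (y - a))\<^sup>2 - c * (1 - c) * (norm (x - y))\<^sup>2"
      by (simp only: power2_norm_eq_inner) (simp add: algebra_simps inner_commute)
    define X Y Z where "X = (norm (x - a))\<^sup>2" and "Y = (norm (y - a))\<^sup>2" and "Z = (norm (x - y))\<^sup>2"
    have "\<phi> (c *\<^sub>R x + (1 - c) *\<^sub>R y) = c * (w \<bullet> x) + (1 - c) * (w \<bullet> y) + (c * X + (1 - c) * Y - c * (1 - c) * Z) / (2 * L)"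
      unfolding \<phi>_def eq X_def Y_def Z_def by (simp add: inner_add_right)
    also have "\<dots> = c * \<phi> x + (1 - c) * \<phi> y - (1 / L) / 2 * c * (1 - c) * Z"
      unfolding \<phi>_def X_def[symmetric] Y_def[symmetric]
      by (simp add: add_divide_distrib diff_divide_distrib algebra_simps)
    finally show ?thesis by (simp add: Z_def)
  qed
  have "continuous_on UNIV \<phi>" unfolding \<phi>_def using L by (intro continuous_intros) auto
  then have h: "proper_fun h" "closed_fun h" "strongly_convex_fun (0 + 1 / L) h"
    unfolding h_def
    using convex_fun_strongly_convex_0[OF g_proper g_convex] conv
    by (blast intro: proper_fun_add closed_fun_add strongly_convex_fun_add g_proper g_closed)+
  obtain z m where z: "h z = ereal m" "\<And>v. h z \<le> h v"
    using strongly_convex_fun_has_min[OF h(1,2) _ h(3)] L by auto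
  then obtain c where c: "g z = ereal c" unfolding h_def by (cases "g z") auto
  then have m: "m = c + \<phi> z" using z(1) by (simp add: h_def)
  define y where "y = w + (1 / L) *\<^sub>R (z - a)"
  have zy: "z = a + L *\<^sub>R (y - w)" using L by (simp add: y_def)
  have sub: "ereal (c - y \<bullet> (u - z)) \<le> g u" for u
  proof -
    have "y \<bullet> (u - z) = w \<bullet> u - w \<bullet> z + (u - z) \<bullet> (z - a) / L"
      by (simp add: y_def inner_add_left inner_diff_right[of w] inner_commute[of "u - z"])
    \<comment> \<open>The growth of \<open>h\<close> around \<open>z\<close> has modulus 1/L,
      exactly that of \<phi>, so the squares cancel and an affine minorant of \<open>g\<close>
      remains.\<close>
    then have "m + 1 / L / 2 * (norm (u - z))\<^sup>2 - \<phi> u = c - y \<bullet> (u - z)"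
      unfolding m \<phi>_def norm_diff_power2[of u a z] by (simp add: add_divide_distrib)
    moreover have "ereal (m + 1 / L / 2 * (norm (u - z))\<^sup>2) \<le> g u + ereal (\<phi> u)"
      using strongly_convex_fun_growth[OF h(3) z, of u] by (simp add: h_def)
    ultimately show ?thesis by (cases "g u") auto
  qed
  have Gy: "dual_G g y = ereal (- (y \<bullet> z) - c)" using c sub by (rule dual_G_eq)
  define m' where "m' = rF w + ((y - w) \<bullet> a + L / 2 * (norm (y - w))\<^sup>2) + (- (y \<bullet> z) - c)"
  have Qy: "dual_Q f g A L y w = ereal m'"
    unfolding dual_Q_eq Gy m'_def by (simp add: a_def)
  \<comment> \<open>G is replaced by its affine minorant through \<open>z\<close>. The resulting
    quadratic in \<open>v\<close> has gradient a + L (y - w) - z = 0 at \<open>y\<close>, so it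
    grows by exactly L/2 |v - y|^2; this also makes the minimizer unique and pins down the choice in
    \<open>prox_step\<close>.\<close>
  have Qv: "ereal (m' + L / 2 * (norm (v - y))\<^sup>2) \<le> dual_Q f g A L v w" for v
  proof -
    have "m' + L / 2 * (norm (v - y))\<^sup>2 = rF w + ((v - w) \<bullet> a + L / 2 * (norm (v - w))\<^sup>2) + (- (v \<bullet> z) - c)"
      unfolding m'_def norm_diff_power2[of v w y]
      by (subst (1 2) zy) (simp add: inner_diff_left inner_diff_right inner_add_right algebra_simps)
    then have "ereal (m' + L / 2 * (norm (v - y))\<^sup>2)
       = ereal (rF w + ((v - w) \<bullet> a + L / 2 * (norm (v - w))\<^sup>2)) + ereal (- (v \<bullet> z) - c)" by simp
    also have "\<dots> \<le> dual_Q f g A L v w"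
      unfolding dual_Q_eq a_def by (intro add_left_mono dual_G_ge c)
    finally show ?thesis .
  qed
  have "ereal m' \<le> dual_Q f g A L v w" for v
    by (rule order_trans[OF _ Qv]) (use L in simp)
  then have "is_arg_min (\<lambda>v. dual_Q f g A L v w) (\<lambda>_. True) y"
    unfolding is_arg_min_linorder Qy by blast
  then have "is_arg_min (\<lambda>v. dual_Q f g A L v w) (\<lambda>_. True) (prox_step f g A L w)"
    unfolding prox_step_def arg_min_def by (rule someI)
  then have "dual_Q f g A L (prox_step f g A L w) w \<le> ereal m'"
    unfolding is_arg_min_linorder Qy[symmetric] by simp
  with Qv have "ereal (m' + L / 2 * (norm (prox_step f g A L w - y))\<^sup>2) \<le> ereal m'"
    by (rule order_trans)
  then have "prox_step f g A L w = y"
    using L by (simp add: mult_le_0_iff)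
  with that zy c sub show ?thesis by (simp add: a_def)
qed

text \<open>The three-point inequality of the proximal step: the descent condition at
  \<open>p\<close> is combined with the linearization of F at \<open>w\<close> and the minorant of G
  through \<open>z\<close>. Taking \<open>v\<close> as y*, as the preceding iterate, or as
  \<open>w\<close> itself gives every inequality the convergence proof uses.\<close>

lemma prox_step_descent:
  assumes L: "0 < L" and "descent_cond f g A L w" and p: "p = prox_step f g A L w"
    and v: "dual_q f g A v = ereal qv"
  shows "qv + L * ((norm (p - w))\<^sup>2 / 2 + (w - v) \<bullet> (p - w)) \<le> real_of_ereal (dual_q f g A p)"
proof -
  obtain z c where z: "z = AX w + L *\<^sub>R (p - w)" "g z = ereal c" "\<And>u. ereal (c - p \<bullet> (u - z)) \<le> g u"
    using prox_step_dual[OF L, of w] unfolding p by metis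
  note qp = dual_q_eq[OF z(2,3)] and Gp = dual_G_eq[OF z(2,3)]
  have "- (- rF p + p \<bullet> z + c) \<le> rF w + ((p - w) \<bullet> AX w + L / 2 * (norm (p - w))\<^sup>2) + (- (p \<bullet> z) - c)"
    using assms(2) unfolding descent_cond_def dual_qt_def dual_Q_eq p[symmetric] qp Gp
    by simp
  moreover have "qv \<le> - rF v + v \<bullet> z + c" using dual_q_le[OF z(2), of v] v by simp
  moreover have "rF w + (v - w) \<bullet> AX w \<le> rF v" by (rule rF_lower)
  moreover have "v \<bullet> z - p \<bullet> z = (v - p) \<bullet> AX w + L * ((v - w) \<bullet> (p - w) - (norm (p - w))\<^sup>2)"
    unfolding z(1) power2_norm_eq_inner by (simp add: inner_diff_left inner_diff_right inner_add_right algebra_simps)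
  ultimately show ?thesis
    unfolding qp real_of_ereal.simps by (simp add: inner_diff_left inner_diff_right algebra_simps)
qed

lemma prox_step_dual_q_finite:
  assumes "0 < L" shows "dual_q f g A (prox_step f g A L w) = ereal (real_of_ereal (dual_q f g A (prox_step f g A L w)))"
proof -
  obtain z c where "g z = ereal c" "\<And>u. ereal (c - prox_step f g A L w \<bullet> (u - z)) \<le> g u"
    using prox_step_dual[OF assms, of w] by metis
  from dual_q_eq[OF this] show ?thesis by simp
qed

text \<open>Any two minimizers z differ in their infeasibility; the one closest to A x(y) inherits the
  bound from the particular minimizer produced by a proximal step, whatever L and w are.\<close>
definition zsel :: "real^'m \<Rightarrow> real^'m" where
  "zsel y = closest_point (primal_z_set g y) (AX y)"

lemma zsel_in: "primal_z_set g y \<noteq> {} \<Longrightarrow> zsel y \<in> primal_z_set g y"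
  unfolding zsel_def by (rule closest_point_in_set[OF closed_primal_z_set])

lemma prox_step_zsel:
  assumes L: "0 < L" and p: "p = prox_step f g A L w"
  shows "zsel p \<in> primal_z_set g p" "norm (AX p - zsel p) \<le> (L + lip_F \<sigma> A) * norm (p - w)"
proof -
  obtain z c where z: "z = AX w + L *\<^sub>R (p - w)" "g z = ereal c" "\<And>u. ereal (c - p \<bullet> (u - z)) \<le> g u"
    using prox_step_dual[OF L, of w] unfolding p by metis
  have "ereal (p \<bullet> z) + g z \<le> ereal (p \<bullet> u) + g u" for u
    using z(3)[of u] unfolding z(2) by (cases "g u") (auto simp: inner_diff_right)
  then have zin: "z \<in> primal_z_set g p" by (simp add: primal_z_set_def is_arg_min_linorder)
  then show "zsel p \<in> primal_z_set g p" by (intro zsel_in) auto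
  have "norm (AX p - zsel p) \<le> norm (AX p - z)"
    using closest_point_le[OF closed_primal_z_set zin] by (simp add: zsel_def dist_norm)
  also have "AX p - z = (AX p - AX w) - L *\<^sub>R (p - w)" by (simp add: z(1))
  also have "norm \<dots> \<le> norm (AX p - AX w) + norm (L *\<^sub>R (p - w))" by (rule norm_triangle_ineq4)
  also have "\<dots> \<le> lip_F \<sigma> A * norm (p - w) + L * norm (p - w)"
    using L AX_lipschitz[of p w] by simp
  finally show "norm (AX p - zsel p) \<le> (L + lip_F \<sigma> A) * norm (p - w)" by (simp add: algebra_simps)
qed

lemma primal_z_selection_zsel: "primal_z_selection f g A zsel"
  unfolding primal_z_selection_def using zsel_in prox_step_zsel(1) by blast

section \<open>Primal-dual gaps at proximal points\<close>

lemma gapt_bound: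
  assumes "0 < L" "p = prox_step f g A L w"
  shows "primal_Ht f g (primal_x f A p) (zsel p) - dual_q f g A p
    \<le> ereal (norm p * ((L + lip_F \<sigma> A) * norm (p - w)))"
proof -
  obtain c where c: "g (zsel p) = ereal c" "\<And>u. ereal (c - p \<bullet> (u - zsel p)) \<le> g u"
    using primal_z_setD[OF prox_step_zsel(1)[OF assms]] by blast
  have "primal_Ht f g (primal_x f A p) (zsel p) - dual_q f g A p = ereal (p \<bullet> (AX p - zsel p))"
    unfolding dual_q_eq[OF c] primal_Ht_def f_primal_x c(1) by (simp add: rF_def inner_diff_right)
  also have "p \<bullet> (AX p - zsel p) \<le> norm p * norm (AX p - zsel p)" by (rule norm_cauchy_schwarz)
  also have "\<dots> \<le> norm p * ((L + lip_F \<sigma> A) * norm (p - w))"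
    by (intro mult_left_mono prox_step_zsel(2)[OF assms]) simp
  finally show ?thesis by simp
qed

lemma norm_subgradient_le:
  assumes "bdd_above (norm ` all_subgradients g)" "d \<in> subdiff g v"
  shows "norm d \<le> max_subgradient_norm g"
  unfolding max_subgradient_norm_def using assms by (intro cSUP_upper) (auto simp: all_subgradients_def)

lemma max_subgradient_norm_nonneg:
  assumes "bdd_above (norm ` all_subgradients g)" "\<And>v. subdiff g v \<noteq> {}"
  shows "0 \<le> max_subgradient_norm g"
  using norm_subgradient_le[OF assms(1)] assms(2) by (metis ex_in_conv norm_ge_zero order_trans)

text \<open>Replacing z by A x(p) changes the value of \<open>g\<close> by at most the subgradient
  norm at A x(p) times the infeasibility, which adds \<gamma> to |p|. The same subgradient
  inequality shows that \<open>g\<close> is finite at A x(p).\<close>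

lemma gap_bound:
  assumes "0 < L" "p = prox_step f g A L w"
    and sub: "\<And>v. subdiff g v \<noteq> {}" and bdd: "bdd_above (norm ` all_subgradients g)"
  shows "primal_H f g A (primal_x f A p) - dual_q f g A p
    \<le> ereal ((norm p + max_subgradient_norm g) * ((L + lip_F \<sigma> A) * norm (p - w)))"
proof -
  let ?\<gamma> = "max_subgradient_norm g"
  obtain c where c: "g (zsel p) = ereal c" "\<And>u. ereal (c - p \<bullet> (u - zsel p)) \<le> g u"
    using primal_z_setD[OF prox_step_zsel(1)[OF assms(1,2)]] by blast
  obtain d where d: "d \<in> subdiff g (AX p)" using sub by blast
  have \<gamma>: "norm d \<le> ?\<gamma>" "0 \<le> ?\<gamma>"
    using norm_subgradient_le[OF bdd d] max_subgradient_norm_nonneg[OF bdd sub] .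
  have dz: "g (AX p) + ereal (d \<bullet> (zsel p - AX p)) \<le> ereal c"
    unfolding c(1)[symmetric] using d by (simp add: subdiff_def)
  moreover have "g (AX p) \<noteq> -\<infinity>" using g_proper by (simp add: proper_fun_def)
  ultimately obtain b where b: "g (AX p) = ereal b" by (cases "g (AX p)") auto
  have "b - c \<le> d \<bullet> (AX p - zsel p)" using dz by (simp add: b inner_diff_right)
  also have "\<dots> \<le> norm d * norm (AX p - zsel p)" by (rule norm_cauchy_schwarz)
  also have "\<dots> \<le> ?\<gamma> * norm (AX p - zsel p)" using \<gamma>(1) by (rule mult_right_mono) simp
  finally have bc: "b - c \<le> ?\<gamma> * norm (AX p - zsel p)" .
  have "primal_H f g A (primal_x f A p) - dual_q f g A p = ereal (p \<bullet> (AX p - zsel p) + (b - c))"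
    unfolding dual_q_eq[OF c] primal_H_def f_primal_x AX_def[symmetric] b by (simp add: rF_def inner_diff_right)
  also have "p \<bullet> (AX p - zsel p) + (b - c) \<le> norm p * norm (AX p - zsel p) + ?\<gamma> * norm (AX p - zsel p)"
    by (rule add_mono[OF norm_cauchy_schwarz bc])
  also have "\<dots> = (norm p + ?\<gamma>) * norm (AX p - zsel p)" by (simp add: distrib_right)
  also have "\<dots> \<le> (norm p + ?\<gamma>) * ((L + lip_F \<sigma> A) * norm (p - w))"
    using \<gamma> by (intro mult_left_mono prox_step_zsel(2)[OF assms(1,2)]) simp
  finally show ?thesis by simp
qed

end

lemma Min_image_Un_le:
  fixes h :: "'b \<Rightarrow> 'a::linorder"
  assumes "finite I" "i \<in> I \<and> h i \<le> c \<or> d \<le> c"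
  shows "Min (h ` I \<union> {d}) \<le> c"
  using assms by (subst Min_le_iff) auto

section \<open>The convergence rate\<close>

context dual_problem
begin

text \<open>An iterate is recorded only as a proximal point with some constant l \<le> L', since the
  gap bounds ask for nothing more and increase with l.\<close>

lemma gfdpg_residual:
  fixes a :: real
  assumes a: "2 < a" and t: "\<And>i. t i = (real i + a) / a"
    and alg: "gfdpg f g A L t y w" and max: "\<And>v. dual_q f g A v \<le> dual_q f g A ystar"
    and k: "1 \<le> k" and L': "L k \<le> L'" and descent: "descent_cond f g A L' (y k)"
  defines "p' \<equiv> prox_step f g A L' (y k)"
  defines "R \<equiv> norm (y 0 - ystar)"
  defines "B \<equiv> a * sqrt 6 / sqrt (a - 2) * (R / real k powr (3/2))"
  shows "(\<exists>i\<in>{1..k}. \<exists>l v. 0 < l \<and> l \<le> L' \<and> y i = prox_step f g A l v \<and>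
             norm (y i - v) \<le> B \<and> norm (y i - ystar) \<le> R)
    \<or> 0 < L' \<and> norm (p' - y k) \<le> B \<and> norm (p' - ystar) \<le> R"
proof -
  define T where "T = (\<lambda>k. \<Sum>i\<le>k. t i)"
  have init: "0 < L 0" "w 0 = y 0" "0 < t 0" "t 0 \<le> 1"
    and upd: "\<And>j. L j \<le> L (Suc j)" "\<And>j. descent_cond f g A (L (Suc j)) (w j)"
      "\<And>j. y (Suc j) = prox_step f g A (L (Suc j)) (w j)"
      "\<And>j. 0 < t (Suc j)" "\<And>j. (t (Suc j))\<^sup>2 \<le> T (Suc j)"
      "\<And>j. w (Suc j) = y (Suc j)
           + ((T j - t j) * t (Suc j) / (t j * T (Suc j))) *\<^sub>R (y (Suc j) - y j)
           + (((t j)\<^sup>2 - T j) * t (Suc j) / (t j * T (Suc j))) *\<^sub>R (y (Suc j) - w j)"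
    using alg unfolding gfdpg_def Let_def T_def by (fastforce dest: spec[of _ "Suc _"])+
  have Lj_pos: "0 < L j" for j
    by (induction j) (auto intro: init(1) less_le_trans[OF _ upd(1)])
  define qr where "qr v = real_of_ereal (dual_q f g A v)" for v
  have q_y: "dual_q f g A (y (Suc j)) = ereal (qr (y (Suc j)))" for j
    unfolding qr_def upd(3) by (rule prox_step_dual_q_finite[OF Lj_pos])
  obtain z c where "g z = ereal c" using g_proper unfolding proper_fun_def by (metis ereal_cases)
  from dual_q_le[OF this, of ystar] max[of "y (Suc 0)"] q_y[of 0]
  have q_star: "dual_q f g A ystar = ereal (qr ystar)"
    unfolding qr_def by (cases "dual_q f g A ystar") auto
  define v where "v j = qr ystar - qr (y j)" for j
  have L'_pos: "0 < L'" using Lj_pos L' by (rule less_le_trans)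
  interpret momentum L t T v y w ystar
  proof
    fix j
    show "0 < t j" using init(3) upd(4) by (cases j) auto
    show "(t j)\<^sup>2 \<le> T j"
    proof (cases j)
      case 0
      then show ?thesis using init(3,4) by (simp add: T_def power2_eq_square mult_left_le)
    qed (simp add: upd(5))
    show "0 \<le> v (Suc j)" using max[of "y (Suc j)"] by (simp add: v_def q_y q_star)
    show "v (Suc j) \<le> - L (Suc j) * ((norm (y (Suc j) - w j))\<^sup>2 / 2 + (w j - ystar) \<bullet> (y (Suc j) - w j))"
      using prox_step_descent[OF Lj_pos upd(2,3) q_star, of j] by (simp add: v_def qr_def[of "y (Suc j)"])
    show "v (Suc (Suc j)) \<le> v (Suc j)
           - L (Suc (Suc j)) * ((norm (y (Suc (Suc j)) - w (Suc j)))\<^sup>2 / 2 + (w (Suc j) - y (Suc j)) \<bullet> (y (Suc (Suc j)) - w (Suc j)))"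
      using prox_step_descent[OF Lj_pos upd(2,3) q_y, of j "Suc j"] by (simp add: v_def qr_def[of "y (Suc (Suc j))"])
  qed (use init upd in \<open>auto simp: T_def\<close>)
  obtain n where n: "k = Suc n" using k by (cases k) auto
  have p': "p' = prox_step f g A L' (y k)" by (simp add: p'_def)
  have q_p': "dual_q f g A p' = ereal (qr p')"
    unfolding qr_def p' by (rule prox_step_dual_q_finite[OF L'_pos])
  have p'_max: "qr p' \<le> qr ystar" using max[of p'] by (simp add: q_p' q_star)
  define D where "D = Min ((\<lambda>j. norm (y (Suc j) - w j)) ` {..<k} \<union> {norm (p' - y k)})"
  have D_le: "D \<le> norm (p' - y k)" "\<And>j. j < k \<Longrightarrow> D \<le> norm (y (Suc j) - w j)"
    unfolding D_def by (auto intro!: Min_le)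
  have D_in: "D \<in> (\<lambda>j. norm (y (Suc j) - w j)) ` {..<k} \<union> {norm (p' - y k)}"
    unfolding D_def by (intro Min_in) auto
  then have D0: "0 \<le> D" by auto
  have D2: "D\<^sup>2 * (T n + (\<Sum>j\<le>n. T j - (t j)\<^sup>2)) \<le> R\<^sup>2"
    unfolding R_def
  proof (rule residual_bound)
    \<comment> \<open>Here L k \<le> L' carries the ascent of the final step, measured with L', over
      to the constant L k in the Lyapunov weight. In the next inequality \<open>v\<close> =
      \<open>w\<close> = \<open>y k\<close>, so the inner product vanishes.\<close>
    have "L (Suc n) * D\<^sup>2 \<le> L' * (norm (p' - y k))\<^sup>2"
      using L' Lj_pos[of "Suc n"] D_le(1) D0 by (intro mult_mono power_mono) (auto simp: n)
    moreover have "qr (y k) + L' * ((norm (p' - y k))\<^sup>2 / 2) \<le> qr p'"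
      using prox_step_descent[OF L'_pos descent p' q_y[of n, folded n]] by (simp add: qr_def[of p'])
    ultimately show "L (Suc n) * D\<^sup>2 / 2 \<le> v (Suc n)"
      using p'_max by (simp add: v_def n)
  qed (use D_le D0 n in auto)
  have "D \<le> B"
  proof -
    \<comment> \<open>The weight lemma at index \<open>n\<close> yields (n + 1)^3, which is
      k^3.\<close>
    have "D\<^sup>2 * ((a - 2) * real k ^ 3 / (6 * a\<^sup>2)) \<le> D\<^sup>2 * (T n + (\<Sum>j\<le>n. T j - (t j)\<^sup>2))"
      using linear_stepsizes_weight[OF a, of n] unfolding T_def t n
      by (intro mult_left_mono) (simp_all add: add.commute)
    with D2 have "D\<^sup>2 * ((a - 2) * real k ^ 3 / (6 * a\<^sup>2)) \<le> R\<^sup>2" by linarith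
    then have "D\<^sup>2 \<le> a\<^sup>2 * 6 / (a - 2) * (R\<^sup>2 / real k ^ 3)"
      using a k by (simp add: field_simps)
    also have "\<dots> = B\<^sup>2"
    proof -
      have "(real k powr (3/2))\<^sup>2 = real k powr 3" using k by (simp add: powr_power)
      also have "\<dots> = real k ^ 3" using k by (simp add: powr_numeral)
      finally have "(real k powr (3/2))\<^sup>2 = real k ^ 3" .
      then show ?thesis using a by (simp add: B_def power_mult_distrib power_divide)
    qed
    finally show ?thesis by (rule power2_le_imp_le) (use a in \<open>simp add: B_def R_def\<close>)
  qed
  from D_in show ?thesis
  proof
    assume "D \<in> (\<lambda>j. norm (y (Suc j) - w j)) ` {..<k}"
    then obtain j where j: "j < k" "D = norm (y (Suc j) - w j)" by auto
    have "L (Suc j) \<le> L k" using lift_Suc_mono_le[of L, OF upd(1)] j(1) by simp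
    then have "L (Suc j) \<le> L'" using L' by (rule order_trans)
    moreover have "norm (y (Suc j) - w j) \<le> B" using j(2) \<open>D \<le> B\<close> by simp
    moreover have "norm (y (Suc j) - ystar) \<le> R" unfolding R_def by (rule iterates_bounded)
    moreover have "Suc j \<in> {1..k}" using j(1) by simp
    ultimately show ?thesis using Lj_pos[of "Suc j"] upd(3)[of j] by blast
  next
    assume "D \<in> {norm (p' - y k)}"
    moreover have "norm (p' - ystar) \<le> R"
    proof -
      \<comment> \<open>The argument of \<open>fejer\<close>, repeated because \<open>p'\<close> is
        not one of the iterates of the recursion.\<close>
      have "L' * ((norm (p' - y k))\<^sup>2 / 2 + (y k - ystar) \<bullet> (p' - y k)) \<le> 0"
        using prox_step_descent[OF L'_pos descent p' q_star] p'_max by (simp add: qr_def[of p'])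
      then have "(norm (p' - y k))\<^sup>2 / 2 + (y k - ystar) \<bullet> (p' - y k) \<le> 0"
        using L'_pos by (simp add: mult_le_0_iff)
      then have "(norm (p' - ystar))\<^sup>2 \<le> (norm (y k - ystar))\<^sup>2"
        using norm_sum_power2[of "y k - ystar" 1 "p' - y k"] by simp
      then have "norm (p' - ystar) \<le> norm (y k - ystar)" by (rule power2_le_imp_le) simp
      with iterates_bounded[of k] show ?thesis by (simp add: R_def)
    qed
    ultimately show ?thesis using \<open>D \<le> B\<close> L'_pos by auto
  qed
qed

text \<open>The slack \<open>e\<close> is 0 for the gap with z(y) and \<gamma> for the gap with H,
  so one estimate gives both right-hand sides.\<close>

lemma residual_product_bound:
  assumes "norm (p - v) \<le> b * (R / K)" "norm (p - ystar) \<le> R" "0 < l" "l \<le> L'" "0 \<le> e"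
  shows "(norm p + e) * ((l + lip_F \<sigma> A) * norm (p - v))
    \<le> b * (L' + lip_F \<sigma> A) * (R + norm ystar + e) * (R / K)"
proof -
  have "norm p \<le> R + norm ystar" using norm_triangle_sub[of p ystar] assms(2) by linarith
  moreover from this have "0 \<le> R + norm ystar" by (meson norm_ge_zero order_trans)
  ultimately have "(norm p + e) * ((l + lip_F \<sigma> A) * norm (p - v)) \<le> (R + norm ystar + e) * ((L' + lip_F \<sigma> A) * (b * (R / K)))"
    using assms lip_F_nonneg by (intro mult_mono add_mono mult_nonneg_nonneg) auto
  then show ?thesis by (simp add: mult_ac)
qed

end

theorem theorem5p2:
  fixes f :: "real^'n \<Rightarrow> ereal" and g :: "real^'m \<Rightarrow> ereal"
    and A :: "real^'n^'m" and \<sigma> :: real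
  assumes "proper_fun f" "closed_fun f" "convex_fun f"
    and "proper_fun g" "closed_fun g" "convex_fun g"
    and "0 < \<sigma>" "strongly_convex_fun \<sigma> f"
  shows "\<exists>z. primal_z_selection f g A z \<and>
    (\<forall>(a::real) (L :: nat \<Rightarrow> real) (t :: nat \<Rightarrow> real) (y :: nat \<Rightarrow> real^'m) (w :: nat \<Rightarrow> real^'m)
       (ystar :: real^'m) (k::nat) (L'::real).
       a > 2 \<longrightarrow>
       (\<forall>i. t i = (real i + a) / a) \<longrightarrow>
       gfdpg f g A L t y w \<longrightarrow>
       (\<forall>v. dual_q f g A v \<le> dual_q f g A ystar) \<longrightarrow>
       k \<ge> 1 \<longrightarrow>
       L k \<le> L' \<longrightarrow>
       descent_cond f g A L' (y k) \<longrightarrow>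
       (let p' = prox_step f g A L' (y k);
            gapt = (\<lambda>v. primal_Ht f g (primal_x f A v) (z v) - dual_q f g A v);
            gap = (\<lambda>v. primal_H f g A (primal_x f A v) - dual_q f g A v);
            \<gamma> = max_subgradient_norm g
        in
        Min ((\<lambda>i. gapt (y i)) ` {1..k} \<union> {gapt p'})
          \<le> ereal (a * sqrt 6 / sqrt (a - 2) * (L' + lip_F \<sigma> A)
                    * (norm (y 0 - ystar) + norm ystar)
                    * (norm (y 0 - ystar) / real k powr (3/2))) \<and>
        ((\<forall>v. subdiff g v \<noteq> {}) \<and> bdd_above (norm ` all_subgradients g) \<longrightarrow>
         Min ((\<lambda>i. gap (y i)) ` {1..k} \<union> {gap p'})
          \<le> ereal (a * sqrt 6 / sqrt (a - 2) * (L' + lip_F \<sigma> A)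
                    * (norm (y 0 - ystar) + norm ystar + \<gamma>)
                    * (norm (y 0 - ystar) / real k powr (3/2))))))"
proof -
  interpret dual_problem f g A \<sigma> using assms by unfold_locales
  show ?thesis
  \<comment> \<open>\<open>zsel\<close> depends only on \<open>f\<close>, \<open>g\<close> and
    \<open>A\<close>, so it can be supplied before the run is introduced.\<close>
  proof (intro exI[of _ zsel] conjI allI impI primal_z_selection_zsel, unfold Let_def, intro conjI impI)
    fix a :: real and L t :: "nat \<Rightarrow> real" and y w :: "nat \<Rightarrow> real^'m" and ystar k L'
    assume a: "a > 2" and t: "\<forall>i. t i = (real i + a) / a" and alg: "gfdpg f g A L t y w"
      and max: "\<forall>v. dual_q f g A v \<le> dual_q f g A ystar"
      and k: "k \<ge> 1" and L': "L k \<le> L'" and descent: "descent_cond f g A L' (y k)"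
    let ?b = "a * sqrt 6 / sqrt (a - 2)" and ?p' = "prox_step f g A L' (y k)"
    let ?R = "norm (y 0 - ystar)" and ?K = "real k powr (3/2)"
    let ?bound = "\<lambda>e. ereal (?b * (L' + lip_F \<sigma> A) * (?R + norm ystar + e) * (?R / ?K))"
    have best: "(\<exists>i\<in>{1..k}. \<exists>l v. 0 < l \<and> l \<le> L' \<and> y i = prox_step f g A l v \<and>
             norm (y i - v) \<le> ?b * (?R / ?K) \<and> norm (y i - ystar) \<le> ?R)
        \<or> 0 < L' \<and> norm (?p' - y k) \<le> ?b * (?R / ?K) \<and> norm (?p' - ystar) \<le> ?R"
      by (rule gfdpg_residual[OF a _ alg _ k L' descent]) (use t max in auto)
    have Min_gap: "Min ((\<lambda>i. G (y i)) ` {1..k} \<union> {G ?p'}) \<le> ?bound e"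
      if e: "0 \<le> e" and G: "\<And>l p v. 0 < l \<Longrightarrow> p = prox_step f g A l v \<Longrightarrow>
        G p \<le> ereal ((norm p + e) * ((l + lip_F \<sigma> A) * norm (p - v)))" for G :: "real^'m \<Rightarrow> ereal" and e
    proof -
      have *: "G p \<le> ?bound e"
        if "0 < l" "l \<le> L'" "p = prox_step f g A l v" "norm (p - v) \<le> ?b * (?R / ?K)" "norm (p - ystar) \<le> ?R" for l p v
        using G[OF that(1,3)] residual_product_bound[OF that(4,5,1,2) e] by (meson ereal_less_eq(3) order_trans)
      from best show ?thesis
      proof
        assume "\<exists>i\<in>{1..k}. \<exists>l v. 0 < l \<and> l \<le> L' \<and> y i = prox_step f g A l v \<and>
             norm (y i - v) \<le> ?b * (?R / ?K) \<and> norm (y i - ystar) \<le> ?R"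
        then obtain i where "i \<in> {1..k}" "G (y i) \<le> ?bound e" using * by blast
        then show ?thesis by (intro Min_image_Un_le[where i = i]) auto
      next
        assume "0 < L' \<and> norm (?p' - y k) \<le> ?b * (?R / ?K) \<and> norm (?p' - ystar) \<le> ?R"
        then have "G ?p' \<le> ?bound e" using * by blast
        then show ?thesis by (intro Min_image_Un_le) auto
      qed
    qed
    show "Min ((\<lambda>i. primal_Ht f g (primal_x f A (y i)) (zsel (y i)) - dual_q f g A (y i)) ` {1..k} \<union>
        {primal_Ht f g (primal_x f A ?p') (zsel ?p') - dual_q f g A ?p'})
      \<le> ereal (?b * (L' + lip_F \<sigma> A) * (?R + norm ystar) * (?R / ?K))"
      using Min_gap[of 0 "\<lambda>v. primal_Ht f g (primal_x f A v) (zsel v) - dual_q f g A v"] gapt_bound by simp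
    assume g: "(\<forall>v. subdiff g v \<noteq> {}) \<and> bdd_above (norm ` all_subgradients g)"
    show "Min ((\<lambda>i. primal_H f g A (primal_x f A (y i)) - dual_q f g A (y i)) ` {1..k} \<union>
        {primal_H f g A (primal_x f A ?p') - dual_q f g A ?p'})
      \<le> ?bound (max_subgradient_norm g)"
      using g by (intro Min_gap gap_bound max_subgradient_norm_nonneg) auto
  qed
qed

end
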